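(* Let $\mathbf{b}=(b^x,b^y,b^z)$ be a divergence-free vector field on the box $\Omega$, let $\alpha,\beta\in[0,1]$, and let $\mathbf{C}_{pq}$ and $\mathbf{C}_{qp}$ be the matrices of the discrete parallel gradients $\nabla_\parallel|_{pq}$ (with parameter $\alpha$) and $\nabla_\parallel|_{qp}$ (with parameter $\beta$), with $p=0$ on $\partial\Omega$, as defined in the context. If $\alpha+\beta=1$, then the space-discretized wave problem $$\frac{d}{dt}\begin{bmatrix}\vec p\\ \vec q\end{bmatrix}=\begin{bmatrix}\mathbf{0}&\mathbf{C}_{pq}\\ \mathbf{C}_{qp}&\mathbf{0}\end{bmatrix}\begin{bmatrix}\vec p\\ \vec q\end{bmatrix}$$ is energy-preserving: for every solution $(\vec p(t),\vec q(t))$, $$\frac{d}{dt}\,\frac12\Big(\|\vec p(t)\|^2+\|\vec q(t)\|^2\Big)=0,$$ where $\|\vec p\|^2=\vec p^{\,T}\mathbf{X}_p\vec p$ and $\|\vec q\|^2=\vec q^{\,T}\mathbf{X}_q\vec q$ are the discrete $L^2$ norms.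
   Context: **Continuous problem.** The system discretizes in space $\partial_t p=\nabla_\parallel q$, $\partial_t q=\nabla_\parallel p$ on $\Omega$ with $p=0$ on $\partial\Omega$ ($q$ free on the boundary), where $\nabla_\parallel f=\mathbf{b}\cdot\nabla f=\nabla\cdot(\mathbf{b}f)$ and $\nabla\cdot\mathbf{b}=0$. Its energy is $E=\int_\Omega(p^2/2+q^2/2)\,d\Omega$; the discrete energy is $\frac12(\|\vec p\|^2+\|\vec q\|^2)$. **Grids.** $\Omega\subset\mathbb{R}^3$ is a closed rectangular box. The $p$-grid is the uniform Cartesian grid of nodes $(x_i,y_j,z_k)$, $1\le i\le N_x^p$, $1\le j\le N_y^p$, $1\le k\le N_z^p$, with spacings $\Delta x,\Delta y,\Delta z$, whose first and last nodes in each direction lie on $\partial\Omega$. Write $i^\pm=i\pm\frac12$, $j^\pm=j\pm\frac12$, $k^\pm=k\pm\frac12$. The $q$-grid consists of the cell centres $(x_{i^+},y_{j^+},z_{k^+})$, with $1\le i\le N_x^q=N_x^p-1$, $1\le j\le N_y^q=N_y^p-1$, $1\le k\le N_z^q=N_z^p-1$; it has no nodes on $\partial\Omega$. The field $\mathbf{b}$ is given and can be evaluated on both grids. A grid function is identified with a vector by a fixed enumeration of the nodes. **Boundary conditions.** The $p$-grid values at nodes on $\partial\Omega$ are set to $0$, so the degrees of freedom of $\vec p$ are the values at the interior $p$-nodes ($2\le i\le N_x^p-1$, etc.). Correspondingly, $\mathbf{C}_{pq}$ has rows indexed by interior $p$-nodes and columns indexed by all $q$-nodes, and $\mathbf{C}_{qp}$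 has rows indexed by all $q$-nodes and columns indexed by interior $p$-nodes (it acts on $p$-grid functions extended by $0$ to the boundary nodes). **Discrete derivatives.** For $f$ on the $q$-grid and $(x_i,y_j,z_k)$ an interior $p$-node, $$[D_x|_{pq}f](x_i,y_j,z_k)=\frac{1}{4\Delta x}\sum_{s\in\{j^-,j^+\}}\ \sum_{t\in\{k^-,k^+\}}\big(f(x_{i^+},y_s,z_t)-f(x_{i^-},y_s,z_t)\big).$$ For $f$ on the $p$-grid, $$[D_x|_{qp}f](x_{i^+},y_{j^+},z_{k^+})=\frac{1}{4\Delta x}\sum_{s\in\{j,j+1\}}\ \sum_{t\in\{k,k+1\}}\big(f(x_{i+1},y_s,z_t)-f(x_i,y_s,z_t)\big).$$ $D_y|_{pq},D_z|_{pq},D_y|_{qp},D_z|_{qp}$ are defined analogously (difference in the named direction, average over the four pairs in the other two directions). **Discrete parallel gradients.** For $f$ on the $q$-grid, at a $p$-node, $$\nabla_\parallel|_{pq}f=\alpha\sum_{\delta\in\{x,y,z\}}b^\delta\,D_\delta|_{pq}f+(1-\alpha)\sum_{\delta\in\{x,y,z\}}D_\delta|_{pq}(b^\delta f),$$ where in the first sum $b^\delta$ is evaluated at the $p$-node and in the second the product $b^\delta f$ is formed on the $q$-grid. For $f$ on the $p$-grid, at a $q$-node, $$\nabla_\parallel|_{qp}f=\beta\sum_{\delta\in\{x,y,z\}}b^\delta\,D_\delta|_{qp}f+(1-\beta)\sum_{\delta\in\{x,y,z\}}D_\delta|_{qp}(b^\delta f),$$ where in the first sum $b^\delta$ is evaluated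 at the $q$-node and in the second $b^\delta f$ is formed on the $p$-grid. $\mathbf{C}_{pq}$ and $\mathbf{C}_{qp}$ are the matrices of these linear maps. **Quadrature matrices.** $\mathbf{X}_p$ and $\mathbf{X}_q$ are diagonal positive definite matrices of quadrature weights. $\mathbf{X}_q$ is $\Delta x\Delta y\Delta z$ times the identity. $\mathbf{X}_p$ is given by the trapezoidal rule; on the interior $p$-nodes (the only degrees of freedom here) all its diagonal entries equal $\Delta x\Delta y\Delta z$. *)

theory Defs
  imports "HOL-Analysis.Derivative" "Jordan_Normal_Form.Matrix"
begin

type_synonym point = "real \<times> real \<times> real"
type_synonym node = "nat \<times> nat \<times> nat"

definition divergence_free_on :: "('a::euclidean_space \<Rightarrow> 'a) \<Rightarrow> 'a set \<Rightarrow> bool" where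
  "divergence_free_on F S \<longleftrightarrow>
     (\<forall>x\<in>S. \<exists>D. (F has_derivative D) (at x within S) \<and> (\<Sum>e\<in>Basis. inner (D e) e) = 0)"

text \<open>
  \<open>first_node\<close> is \<open>(x\<^sub>1, y\<^sub>1, z\<^sub>1)\<close>, and \<open>num_x\<close>, \<open>num_y\<close>, \<open>num_z\<close> are the numbers of
  \<open>p\<close>-nodes in the three directions.
\<close>

record staggered_grid =
  first_node :: point
  step_x :: real
  step_y :: real
  step_z :: real
  num_x :: nat
  num_y :: nat
  num_z :: nat

definition valid_grid :: "staggered_grid \<Rightarrow> bool" where
  "valid_grid G \<longleftrightarrow> step_x G > 0 \<and> step_y G > 0 \<and> step_z G > 0 \<and>
     num_x G \<ge> 2 \<and> num_y G \<ge> 2 \<and> num_z G \<ge> 2"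

fun grid_point :: "staggered_grid \<Rightarrow> point \<Rightarrow> point" where
  "grid_point G (r, s, t) = (case first_node G of (x1, y1, z1) \<Rightarrow>
     (x1 + (r - 1) * step_x G, y1 + (s - 1) * step_y G, z1 + (t - 1) * step_z G))"

text \<open>
  The index \<open>(i, j, k)\<close> stands for \<open>(x\<^sub>i, y\<^sub>j, z\<^sub>k)\<close> on the \<open>p\<close>-grid and for the cell centre
  \<open>(x\<^sub>i\<^sub>+\<^sub>1\<^sub>/\<^sub>2, y\<^sub>j\<^sub>+\<^sub>1\<^sub>/\<^sub>2, z\<^sub>k\<^sub>+\<^sub>1\<^sub>/\<^sub>2)\<close> on the \<open>q\<close>-grid. So around the \<open>p\<close>-node with index \<open>i\<close>, the half-integer
  indices \<open>i - 1/2\<close> and \<open>i + 1/2\<close> are the \<open>q\<close>-indices \<open>i - 1\<close> and \<open>i\<close>.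
\<close>

fun p_point :: "staggered_grid \<Rightarrow> node \<Rightarrow> point" where
  "p_point G (i, j, k) = grid_point G (real i, real j, real k)"

fun q_point :: "staggered_grid \<Rightarrow> node \<Rightarrow> point" where
  "q_point G (i, j, k) = grid_point G (real i + 1/2, real j + 1/2, real k + 1/2)"

definition grid_box :: "staggered_grid \<Rightarrow> point set" where
  "grid_box G = cbox (p_point G (1, 1, 1)) (p_point G (num_x G, num_y G, num_z G))"

definition p_interior :: "staggered_grid \<Rightarrow> node set" where
  "p_interior G = {2..num_x G - 1} \<times> {2..num_y G - 1} \<times> {2..num_z G - 1}"

definition q_nodes :: "staggered_grid \<Rightarrow> node set" where
  "q_nodes G = {1..num_x G - 1} \<times> {1..num_y G - 1} \<times> {1..num_z G - 1}"

fun Dx_pq :: "staggered_grid \<Rightarrow> (node \<Rightarrow> real) \<Rightarrow> node \<Rightarrow> real" where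
  "Dx_pq G f (i, j, k) = 1 / (4 * step_x G) *
     (\<Sum>s\<in>{j - 1, j}. \<Sum>t\<in>{k - 1, k}. f (i, s, t) - f (i - 1, s, t))"

fun Dy_pq :: "staggered_grid \<Rightarrow> (node \<Rightarrow> real) \<Rightarrow> node \<Rightarrow> real" where
  "Dy_pq G f (i, j, k) = 1 / (4 * step_y G) *
     (\<Sum>r\<in>{i - 1, i}. \<Sum>t\<in>{k - 1, k}. f (r, j, t) - f (r, j - 1, t))"

fun Dz_pq :: "staggered_grid \<Rightarrow> (node \<Rightarrow> real) \<Rightarrow> node \<Rightarrow> real" where
  "Dz_pq G f (i, j, k) = 1 / (4 * step_z G) *
     (\<Sum>r\<in>{i - 1, i}. \<Sum>s\<in>{j - 1, j}. f (r, s, k) - f (r, s, k - 1))"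

fun Dx_qp :: "staggered_grid \<Rightarrow> (node \<Rightarrow> real) \<Rightarrow> node \<Rightarrow> real" where
  "Dx_qp G f (i, j, k) = 1 / (4 * step_x G) *
     (\<Sum>s\<in>{j, j + 1}. \<Sum>t\<in>{k, k + 1}. f (i + 1, s, t) - f (i, s, t))"

fun Dy_qp :: "staggered_grid \<Rightarrow> (node \<Rightarrow> real) \<Rightarrow> node \<Rightarrow> real" where
  "Dy_qp G f (i, j, k) = 1 / (4 * step_y G) *
     (\<Sum>r\<in>{i, i + 1}. \<Sum>t\<in>{k, k + 1}. f (r, j + 1, t) - f (r, j, t))"

fun Dz_qp :: "staggered_grid \<Rightarrow> (node \<Rightarrow> real) \<Rightarrow> node \<Rightarrow> real" where
  "Dz_qp G f (i, j, k) = 1 / (4 * step_z G) *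
     (\<Sum>r\<in>{i, i + 1}. \<Sum>s\<in>{j, j + 1}. f (r, s, k + 1) - f (r, s, k))"

abbreviation x_comp :: "point \<Rightarrow> real" where "x_comp v \<equiv> fst v"
abbreviation y_comp :: "point \<Rightarrow> real" where "y_comp v \<equiv> fst (snd v)"
abbreviation z_comp :: "point \<Rightarrow> real" where "z_comp v \<equiv> snd (snd v)"

definition par_grad_pq ::
    "staggered_grid \<Rightarrow> (point \<Rightarrow> point) \<Rightarrow> real \<Rightarrow> (node \<Rightarrow> real) \<Rightarrow> node \<Rightarrow> real" where
  "par_grad_pq G b \<alpha> f n =
     \<alpha> * (x_comp (b (p_point G n)) * Dx_pq G f n
        + y_comp (b (p_point G n)) * Dy_pq G f n
        + z_comp (b (p_point G n)) * Dz_pq G f n)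
     + (1 - \<alpha>) * (Dx_pq G (\<lambda>m. x_comp (b (q_point G m)) * f m) n
        + Dy_pq G (\<lambda>m. y_comp (b (q_point G m)) * f m) n
        + Dz_pq G (\<lambda>m. z_comp (b (q_point G m)) * f m) n)"

definition par_grad_qp ::
    "staggered_grid \<Rightarrow> (point \<Rightarrow> point) \<Rightarrow> real \<Rightarrow> (node \<Rightarrow> real) \<Rightarrow> node \<Rightarrow> real" where
  "par_grad_qp G b \<beta> f n =
     \<beta> * (x_comp (b (q_point G n)) * Dx_qp G f n
        + y_comp (b (q_point G n)) * Dy_qp G f n
        + z_comp (b (q_point G n)) * Dz_qp G f n)
     + (1 - \<beta>) * (Dx_qp G (\<lambda>m. x_comp (b (p_point G m)) * f m) n
        + Dy_qp G (\<lambda>m. y_comp (b (p_point G m)) * f m) n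
        + Dz_qp G (\<lambda>m. z_comp (b (p_point G m)) * f m) n)"

text \<open>
  \<open>enum_p\<close> enumerates the \<open>np\<close> interior \<open>p\<close>-nodes and \<open>enum_q\<close> the \<open>nq\<close> nodes of the \<open>q\<close>-grid. Column \<open>c\<close> of
  each matrix is the image of the grid function that is 1 at node number \<open>c\<close> and 0 at every other
  node. For \<open>C_qp\<close> this includes the value 0 at the boundary nodes of the \<open>p\<close>-grid.
\<close>

definition unit_fun :: "node \<Rightarrow> node \<Rightarrow> real" where
  "unit_fun m n = (if n = m then 1 else 0)"

definition C_pq ::
    "staggered_grid \<Rightarrow> (point \<Rightarrow> point) \<Rightarrow> real \<Rightarrow> nat \<Rightarrow> (nat \<Rightarrow> node) \<Rightarrow> nat \<Rightarrow> (nat \<Rightarrow> node) \<Rightarrow> real mat" where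
  "C_pq G b \<alpha> np enum_p nq enum_q = mat np nq (\<lambda>(r, c). par_grad_pq G b \<alpha> (unit_fun (enum_q c)) (enum_p r))"

definition C_qp ::
    "staggered_grid \<Rightarrow> (point \<Rightarrow> point) \<Rightarrow> real \<Rightarrow> nat \<Rightarrow> (nat \<Rightarrow> node) \<Rightarrow> nat \<Rightarrow> (nat \<Rightarrow> node) \<Rightarrow> real mat" where
  "C_qp G b \<beta> np enum_p nq enum_q = mat nq np (\<lambda>(r, c). par_grad_qp G b \<beta> (unit_fun (enum_p c)) (enum_q r))"

definition trapezoid_factor :: "nat \<Rightarrow> nat \<Rightarrow> real" where
  "trapezoid_factor N i = (if i = 1 \<or> i = N then 1/2 else 1)"

fun trapezoid_weight :: "staggered_grid \<Rightarrow> node \<Rightarrow> real" where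
  "trapezoid_weight G (i, j, k) =
     trapezoid_factor (num_x G) i * trapezoid_factor (num_y G) j * trapezoid_factor (num_z G) k
     * (step_x G * step_y G * step_z G)"

definition X_p :: "staggered_grid \<Rightarrow> nat \<Rightarrow> (nat \<Rightarrow> node) \<Rightarrow> real mat" where
  "X_p G np enum_p = mat np np (\<lambda>(r, c). if r = c then trapezoid_weight G (enum_p r) else 0)"

definition X_q :: "staggered_grid \<Rightarrow> nat \<Rightarrow> real mat" where
  "X_q G nq = (step_x G * step_y G * step_z G) \<cdot>\<^sub>m 1\<^sub>m nq"

definition weighted_sq_norm :: "real mat \<Rightarrow> real Matrix.vec \<Rightarrow> real" where
  "weighted_sq_norm X v = scalar_prod v (X *\<^sub>v v)"

definition has_vec_derivative ::
    "(real \<Rightarrow> real Matrix.vec) \<Rightarrow> real Matrix.vec \<Rightarrow> real filter \<Rightarrow> bool" where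
  "has_vec_derivative u v F \<longleftrightarrow>
     (\<forall>i<dim_vec v. ((\<lambda>t. vec_index (u t) i) has_real_derivative vec_index v i) F)"

end

theory Submission
  imports Defs
begin

text \<open>
  In each direction, the entry of \<open>D|\<^sub>p\<^sub>q\<close> at \<open>(n, m)\<close> is minus the entry of \<open>D|\<^sub>q\<^sub>p\<close> at \<open>(m, n)\<close>, for
  every interior \<open>p\<close>-node \<open>n\<close>: each pair of neighbouring nodes is
  coupled with coefficient \<open>\<plusminus>1/(4\<Delta>)\<close>, and \<open>n\<close> lies ahead of \<open>m\<close> exactly when \<open>m\<close> lies behind \<open>n\<close>.
  The parallel gradients weight these entries by \<open>\<alpha> b(n) + (1 - \<alpha>) b(m)\<close> and \<open>\<beta> b(m) + (1 - \<beta>) b(n)\<close>,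
  which agree if \<open>\<alpha> + \<beta> = 1\<close>. So the block matrix is skew-symmetric, and since all quadrature
  weights are equal, the energy is a multiple of the Euclidean norm, which a skew-symmetric flow
  preserves.
\<close>

text \<open>Since \<open>unit_fun m\<close> vanishes off \<open>m\<close>, only the value
  \<open>g m\<close> of the factor survives. This reduces the product terms D(b f) of the parallel
  gradients to the plain stencils.\<close>

lemma D_pq_mult_unit_fun:
  "Dx_pq G (\<lambda>l. g l * unit_fun m l) n = g m * Dx_pq G (unit_fun m) n"
  "Dy_pq G (\<lambda>l. g l * unit_fun m l) n = g m * Dy_pq G (unit_fun m) n"
  "Dz_pq G (\<lambda>l. g l * unit_fun m l) n = g m * Dz_pq G (unit_fun m) n"
proof -
  have *: "(\<lambda>l. g l * unit_fun m l) = (\<lambda>l. g m * unit_fun m l)"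
    by (auto simp: unit_fun_def)
  show "Dx_pq G (\<lambda>l. g l * unit_fun m l) n = g m * Dx_pq G (unit_fun m) n"
    "Dy_pq G (\<lambda>l. g l * unit_fun m l) n = g m * Dy_pq G (unit_fun m) n"
    "Dz_pq G (\<lambda>l. g l * unit_fun m l) n = g m * Dz_pq G (unit_fun m) n"
    unfolding * by (cases n; simp add: sum_distrib_left algebra_simps)+
qed

lemma D_qp_mult_unit_fun:
  "Dx_qp G (\<lambda>l. g l * unit_fun m l) n = g m * Dx_qp G (unit_fun m) n"
  "Dy_qp G (\<lambda>l. g l * unit_fun m l) n = g m * Dy_qp G (unit_fun m) n"
  "Dz_qp G (\<lambda>l. g l * unit_fun m l) n = g m * Dz_qp G (unit_fun m) n"
proof -
  have *: "(\<lambda>l. g l * unit_fun m l) = (\<lambda>l. g m * unit_fun m l)"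
    by (auto simp: unit_fun_def)
  show "Dx_qp G (\<lambda>l. g l * unit_fun m l) n = g m * Dx_qp G (unit_fun m) n"
    "Dy_qp G (\<lambda>l. g l * unit_fun m l) n = g m * Dy_qp G (unit_fun m) n"
    "Dz_qp G (\<lambda>l. g l * unit_fun m l) n = g m * Dz_qp G (unit_fun m) n"
    unfolding * by (cases n; simp add: sum_distrib_left algebra_simps)+
qed

text \<open>Splitting the indicator by coordinate lets the index shifts be treated one direction at
  a time.\<close>

lemma unit_fun_triple:
  "unit_fun (i', j', k') (i, j, k) = of_bool (i = i') * of_bool (j = j') * of_bool (k = k')"
  by (auto simp: unit_fun_def)

text \<open>
  Positivity of the indices keeps the truncated \<open>i - 1\<close> in the \<open>pq\<close> stencils distinct from \<open>i\<close>.
\<close>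

lemma D_pq_unit_fun_eq_neg_D_qp:
  assumes "i \<ge> 1" "j \<ge> 1" "k \<ge> 1"
  shows "Dx_pq G (unit_fun m) (i, j, k) = - Dx_qp G (unit_fun (i, j, k)) m"
    and "Dy_pq G (unit_fun m) (i, j, k) = - Dy_qp G (unit_fun (i, j, k)) m"
    and "Dz_pq G (unit_fun m) (i, j, k) = - Dz_qp G (unit_fun (i, j, k)) m"
proof -
  obtain i' j' k' where m: "m = (i', j', k')" by (cases m)
  \<comment> \<open>Trades the predecessor in the \<open>pq\<close> stencil for the successor that
    the \<open>qp\<close> stencil produces.\<close>
  have shift: "of_bool (l - 1 = l') = (of_bool (l = Suc l') :: real)" if "l \<ge> 1" for l l' :: nat
    using that by auto
  have comm: "of_bool (l' = l) = (of_bool (l = l') :: real)"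
    "of_bool (Suc l' = l) = (of_bool (l = Suc l') :: real)" for l l' :: nat
    by auto
  have pair: "(\<Sum>s\<in>{l - 1, l}. f s) = f (l - 1) + f l" if "l \<ge> 1" for l and f :: "nat \<Rightarrow> real"
    using that by (subst sum.insert) auto
  have pair': "(\<Sum>s\<in>{l, Suc l}. f s) = f l + f (Suc l)" for l and f :: "nat \<Rightarrow> real"
    by simp
  \<comment> \<open>The instances of \<open>comm\<close> fix the direction of rewriting, so that
    every index test reads \<open>i = i'\<close> or \<open>i = Suc i'\<close> on both sides, and
    likewise for j and k.\<close>
  note rules = m Dx_pq.simps Dy_pq.simps Dz_pq.simps Dx_qp.simps Dy_qp.simps Dz_qp.simps
    pair[OF assms(1)] pair[OF assms(2)] pair[OF assms(3)] pair' unit_fun_triple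
    shift[OF assms(1)] shift[OF assms(2)] shift[OF assms(3)] Suc_eq_plus1[symmetric]
    comm[of i' i] comm[of j' j] comm[of k' k]
  show "Dx_pq G (unit_fun m) (i, j, k) = - Dx_qp G (unit_fun (i, j, k)) m"
    "Dy_pq G (unit_fun m) (i, j, k) = - Dy_qp G (unit_fun (i, j, k)) m"
    "Dz_pq G (unit_fun m) (i, j, k) = - Dz_qp G (unit_fun (i, j, k)) m"
    unfolding rules by (simp_all add: algebra_simps)
qed

lemma par_grad_unit_fun_skew:
  assumes "n \<in> p_interior G" "\<alpha> + \<beta> = 1"
  shows "par_grad_qp G b \<beta> (unit_fun n) m = - par_grad_pq G b \<alpha> (unit_fun m) n"
proof -
  obtain i j k where n: "n = (i, j, k)" by (cases n)
  have pos: "i \<ge> 1" "j \<ge> 1" "k \<ge> 1"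
    using assms(1) by (auto simp: n p_interior_def)
  have \<beta>: "\<beta> = 1 - \<alpha>" using assms(2) by simp
  show ?thesis
    unfolding par_grad_qp_def par_grad_pq_def D_pq_mult_unit_fun D_qp_mult_unit_fun n
      D_pq_unit_fun_eq_neg_D_qp[OF pos] \<beta>
    by (simp add: algebra_simps)
qed

text \<open>Skewness holds entry by entry, because every \<open>enum_p c\<close> is an interior
  node. It gives the system matrix the block shape that the flow lemma below expects.\<close>

lemma C_qp_eq_neg_transpose_C_pq:
  assumes "enum_p ` {..<np} \<subseteq> p_interior G" "\<alpha> + \<beta> = 1"
  shows "C_qp G b \<beta> np enum_p nq enum_q = - transpose_mat (C_pq G b \<alpha> np enum_p nq enum_q)"
  by (rule eq_matI)
    (use assms in \<open>auto simp: C_qp_def C_pq_def intro!: par_grad_unit_fun_skew\<close>)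

text \<open>Interior indices run from 2 to N - 1, so no factor 1/2 occurs.\<close>

lemma trapezoid_weight_interior:
  "n \<in> p_interior G \<Longrightarrow> trapezoid_weight G n = step_x G * step_y G * step_z G"
  by (cases n) (auto simp: p_interior_def trapezoid_factor_def)

lemma X_p_eq_smult_one:
  assumes "enum_p ` {..<np} \<subseteq> p_interior G"
  shows "X_p G np enum_p = (step_x G * step_y G * step_z G) \<cdot>\<^sub>m 1\<^sub>m np"
  by (rule eq_matI) (use assms in \<open>auto simp: X_p_def intro!: trapezoid_weight_interior\<close>)

lemma weighted_sq_norm_smult_one:
  assumes "v \<in> carrier_vec n"
  shows "weighted_sq_norm (w \<cdot>\<^sub>m 1\<^sub>m n) v = w * (\<Sum>i<n. (vec_index v i)\<^sup>2)"
proof -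
  have "(w \<cdot>\<^sub>m 1\<^sub>m n) *\<^sub>v v = w \<cdot>\<^sub>v v"
    by (rule eq_vecI) (use assms in \<open>auto simp: scalar_prod_smult_left\<close>)
  then show ?thesis
    using assms unfolding weighted_sq_norm_def
    by (simp add: scalar_prod_def power2_eq_square atLeast0LessThan sum_distrib_left ac_simps)
qed

text \<open>Differentiating the squares yields 2 p . (A q) from the first block and -2 q . (A^T p)
  from the second, and these cancel.\<close>

lemma skew_block_flow_preserves_sum_squares:
  fixes p q :: "real \<Rightarrow> real Matrix.vec" and A :: "real mat"
  assumes A: "A \<in> carrier_mat np nq"
    and carrier: "\<And>s. s \<in> T \<Longrightarrow> p s \<in> carrier_vec np \<and> q s \<in> carrier_vec nq"
    and t: "t \<in> T"
    and flow: "has_vec_derivative (\<lambda>s. p s @\<^sub>v q s)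
      (four_block_mat (0\<^sub>m np np) A (- transpose_mat A) (0\<^sub>m nq nq) *\<^sub>v (p t @\<^sub>v q t)) (at t within T)"
  shows "((\<lambda>s. (\<Sum>i<np. (vec_index (p s) i)\<^sup>2) + (\<Sum>j<nq. (vec_index (q s) j)\<^sup>2))
    has_real_derivative 0) (at t within T)"
proof -
  have pt: "p t \<in> carrier_vec np" and qt: "q t \<in> carrier_vec nq"
    using carrier t by auto
  have At: "- transpose_mat A \<in> carrier_mat nq np"
    using A by simp
  have rhs: "four_block_mat (0\<^sub>m np np) A (- transpose_mat A) (0\<^sub>m nq nq) *\<^sub>v (p t @\<^sub>v q t)
      = (A *\<^sub>v q t) @\<^sub>v (- transpose_mat A *\<^sub>v p t)"
    using A At pt qt
    by (subst four_block_mat_mult_vec[of _ np np _ nq _ nq]) auto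
  have dp: "((\<lambda>s. vec_index (p s) i) has_real_derivative (\<Sum>j<nq. A $$ (i, j) * vec_index (q t) j))
      (at t within T)" if i: "i < np" for i
  proof -
    have "((\<lambda>s. vec_index (p s @\<^sub>v q s) i) has_real_derivative vec_index (A *\<^sub>v q t) i)
        (at t within T)"
      using flow[unfolded rhs has_vec_derivative_def, rule_format, of i] A i by simp
    moreover have "vec_index (A *\<^sub>v q t) i = (\<Sum>j<nq. A $$ (i, j) * vec_index (q t) j)"
      using A i qt by (auto simp: scalar_prod_def atLeast0LessThan)
    \<comment> \<open>The appended vector splits this way only where \<open>p s\<close> has
      dimension \<open>np\<close>, which is known on \<open>T\<close>. The derivative within
      \<open>T\<close> sees no other points, so the radius \<open>d = 1\<close> is
      arbitrary.\<close>
    moreover have "vec_index (p s @\<^sub>v q s) i = vec_index (p s) i" if "s \<in> T" for s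
      using carrier[OF that] i by auto
    ultimately show ?thesis
      using t by (auto elim!: has_field_derivative_transform_within[where d = 1])
  qed
  have dq: "((\<lambda>s. vec_index (q s) j) has_real_derivative - (\<Sum>i<np. A $$ (i, j) * vec_index (p t) i))
      (at t within T)" if j: "j < nq" for j
  proof -
    have "((\<lambda>s. vec_index (p s @\<^sub>v q s) (np + j)) has_real_derivative
        vec_index (- transpose_mat A *\<^sub>v p t) j) (at t within T)"
      using flow[unfolded rhs has_vec_derivative_def, rule_format, of "np + j"] A j by simp
    moreover have "vec_index (- transpose_mat A *\<^sub>v p t) j
        = - (\<Sum>i<np. A $$ (i, j) * vec_index (p t) i)"
      using A j pt by (auto simp: scalar_prod_def atLeast0LessThan sum_negf)
    moreover have "vec_index (p s @\<^sub>v q s) (np + j) = vec_index (q s) j" if "s \<in> T" for s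
      using carrier[OF that] j by auto
    ultimately show ?thesis
      using t by (auto elim!: has_field_derivative_transform_within[where d = 1])
  qed
  have "((\<lambda>s. (\<Sum>i<np. (vec_index (p s) i)\<^sup>2) + (\<Sum>j<nq. (vec_index (q s) j)\<^sup>2)) has_real_derivative
      (\<Sum>i<np. 2 * vec_index (p t) i * (\<Sum>j<nq. A $$ (i, j) * vec_index (q t) j)) +
      (\<Sum>j<nq. 2 * vec_index (q t) j * - (\<Sum>i<np. A $$ (i, j) * vec_index (p t) i)))
      (at t within T)"
    by (intro DERIV_add DERIV_sum)
      (auto intro!: derivative_eq_intros dp dq)
  \<comment> \<open>Both double sums are 2 p . (A q), summed by rows and by columns.\<close>
  moreover have "(\<Sum>i<np. 2 * vec_index (p t) i * (\<Sum>j<nq. A $$ (i, j) * vec_index (q t) j))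
      = (\<Sum>j<nq. 2 * vec_index (q t) j * (\<Sum>i<np. A $$ (i, j) * vec_index (p t) i))"
    unfolding sum_distrib_left by (subst sum.swap) (simp add: ac_simps)
  ultimately show ?thesis
    by (simp add: sum_negf)
qed

theorem corollary1p1:
  fixes G :: staggered_grid
    and b :: "point \<Rightarrow> point"
    and \<alpha> \<beta> :: real
    and np nq :: nat
    and enum_p enum_q :: "nat \<Rightarrow> node"
    and T :: "real set"
    and p q :: "real \<Rightarrow> real Matrix.vec"
  assumes "valid_grid G"
    and "divergence_free_on b (grid_box G)"
    and "\<alpha> \<in> {0..1}" and "\<beta> \<in> {0..1}"
    and "\<alpha> + \<beta> = 1"
    and "bij_betw enum_p {..<np} (p_interior G)"
    and "bij_betw enum_q {..<nq} (q_nodes G)"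
    and "is_interval T"
    and "\<forall>t\<in>T. p t \<in> carrier_vec np \<and> q t \<in> carrier_vec nq"
    and "\<forall>t\<in>T. has_vec_derivative (\<lambda>s. p s @\<^sub>v q s)
           (four_block_mat (0\<^sub>m np np) (C_pq G b \<alpha> np enum_p nq enum_q)
                           (C_qp G b \<beta> np enum_p nq enum_q) (0\<^sub>m nq nq) *\<^sub>v (p t @\<^sub>v q t))
           (at t within T)"
  shows "\<forall>t\<in>T. ((\<lambda>s. 1/2 * (weighted_sq_norm (X_p G np enum_p) (p s) + weighted_sq_norm (X_q G nq) (q s)))
           has_real_derivative 0) (at t within T)"
proof
  fix t assume t: "t \<in> T"
  let ?w = "step_x G * step_y G * step_z G"
  have enum: "enum_p ` {..<np} \<subseteq> p_interior G"
    using assms(6) by (auto simp: bij_betw_def)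
  have carrier: "p s \<in> carrier_vec np \<and> q s \<in> carrier_vec nq" if "s \<in> T" for s
    using assms(9) that by blast
  have "((\<lambda>s. (\<Sum>i<np. (vec_index (p s) i)\<^sup>2) + (\<Sum>j<nq. (vec_index (q s) j)\<^sup>2))
      has_real_derivative 0) (at t within T)"
    using assms(10) t
    by (intro skew_block_flow_preserves_sum_squares[of "C_pq G b \<alpha> np enum_p nq enum_q"] carrier)
      (auto simp: C_pq_def C_qp_eq_neg_transpose_C_pq[OF enum assms(5)])
  \<comment> \<open>The factor combines the 1/2 of the energy with the weight \<open>?w\<close>
    common to both norms.\<close>
  from DERIV_cmult[OF this, of "?w / 2"]
  show "((\<lambda>s. 1/2 * (weighted_sq_norm (X_p G np enum_p) (p s) + weighted_sq_norm (X_q G nq) (q s)))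
      has_real_derivative 0) (at t within T)"
    using t carrier unfolding X_p_eq_smult_one[OF enum] X_q_def
    by (auto elim!: has_field_derivative_transform_within[where d = 1]
        simp: weighted_sq_norm_smult_one algebra_simps)
qed

end
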